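(* Let $K:\mathbb{R}^2\to[0,+\infty[$ and $G:[0,+\infty[\to[0,+\infty[$ satisfy the general conditions stated in the context, and consider collocation with $m=2$ and collocation parameters $0=c_1<c_2\le1$. Suppose that either $c_2=1$, or there is $\epsilon>0$ such that for all $0\le s<\epsilon$ the map $t\mapsto K(t,s)$ is continuous in $]s,\epsilon[$. Then there is existence near zero if and only if $\frac{G(y)}{y}$ is unbounded (in $]0,+\infty[$).
   Context: General conditions. The kernel $K:\mathbb{R}^2\to[0,+\infty[$ has its support in $\{(t,s):0\le s\le t\}$; for every $t>0$ the map $s\mapsto K(t,s)$ is locally integrable; $\mathcal K(t):=\int_0^tK(t,s)\,\mathrm{d}s$ is a strictly increasing function; and $\lim_{t\to a^+}\int_a^tK(t,s)\,\mathrm{d}s=0$ for all $a\ge 0$. The nonlinearity $G:[0,+\infty[\to[0,+\infty[$ is continuous, strictly increasing, and $G(0)=0$. Collocation solutions (of the equation $z(t)=G\big(\int_0^tK(t,s)z(s)\,\mathrm{d}s\big)$) for $m=2$, $c_1=0$. Given $0<c_2\le1$ and a mesh $0=t_0<t_1<\dots<t_N$, put $h_n:=t_{n+1}-t_n$, $t_{n,1}:=t_n$, $t_{n,2}:=t_n+c_2h_n$, $L_1(v):=\frac{c_2-v}{c_2}$, $L_2(v):=\frac{v}{c_2}$. A collocation solution $z_h$ in $[0,t_N]$ is a function given by real coefficients $Z_{n,1},Z_{n,2}$ ($0\le n\le N-1$) through $z_h(t_n+vh_n)=L_1(v)Z_{n,1}+L_2(v)Z_{n,2}$ for $v\in\,]0,1]$,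 such that for $n=0,\dots,N-1$ $$Z_{n,1}=G\big(F_n(t_{n,1})\big),\qquad Z_{n,2}=G\big(F_n(t_{n,2})+h_nB_n(2,1)Z_{n,1}+h_nB_n(2,2)Z_{n,2}\big),$$ where $B_n(2,j):=\int_0^{c_2}K(t_{n,2},t_n+sh_n)L_j(s)\,\mathrm{d}s$ and $F_n(t):=\int_0^{t_n}K(t,s)z_h(s)\,\mathrm{d}s$ (in particular the arguments of $G$ must be $\ge0$). It is nontrivial if it is not identically zero in $]t_0,t_1]$. Existence near zero. There is existence near zero if there exists $H_0>0$ such that if $0<h_0\le H_0$ then there are nontrivial collocation solutions in $[0,t_1]$; and moreover, for $n\ge1$ and given $h_0,\dots,h_{n-1}>0$ such that there are nontrivial collocation solutions in $[0,t_n]$, there exists $H_n>0$ (depending in general on $h_0,\dots,h_{n-1}$) such that if $0<h_n\le H_n$ then there are nontrivial collocation solutions in $[0,t_{n+1}]$.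
   Formalization: For c_2<1, existence near zero is taken with the given h_0,...,h_{n-1} also satisfying h_i ≤ H_i (bounds chosen successively), since with arbitrary earlier steps the claim fails: a solution may turn negative and have no continuation; for c_2=1 the literal form is proved too. *)

theory Defs
  imports "HOL-Analysis.Analysis"
begin

text \<open>Kernels \<open>K\<close> are curried, and \<open>G\<close> is a total function of which only the restriction to
  \<open>{0..}\<close> is ever used. All integrals are Lebesgue integrals.\<close>

definition kernel_conditions :: "(real \<Rightarrow> real \<Rightarrow> real) \<Rightarrow> bool" where
  "kernel_conditions K \<longleftrightarrow>
     (\<forall>t s. 0 \<le> K t s) \<and>
     (\<forall>t s. K t s \<noteq> 0 \<longrightarrow> 0 \<le> s \<and> s \<le> t) \<and>
     (\<forall>t>0. \<forall>C. compact C \<longrightarrow> K t absolutely_integrable_on C) \<and>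
     strict_mono_on {0..} (\<lambda>t. LINT s:{0..t}|lebesgue. K t s) \<and>
     (\<forall>a\<ge>0. ((\<lambda>t. LINT s:{a..t}|lebesgue. K t s) \<longlongrightarrow> 0) (at_right a))"

definition nonlinearity_conditions :: "(real \<Rightarrow> real) \<Rightarrow> bool" where
  "nonlinearity_conditions G \<longleftrightarrow>
     (\<forall>y\<ge>0. 0 \<le> G y) \<and> continuous_on {0..} G \<and> strict_mono_on {0..} G \<and> G 0 = 0"

text \<open>A mesh is given by its step sizes \<open>h 0, h 1, \<dots>\<close>; statements about \<open>[0, t\<^sub>N]\<close> only look at
  \<open>h i\<close> for \<open>i < N\<close>.\<close>

definition mesh_point :: "(nat \<Rightarrow> real) \<Rightarrow> nat \<Rightarrow> real" where
  "mesh_point h n = (\<Sum>i<n. h i)"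

definition L1 :: "real \<Rightarrow> real \<Rightarrow> real" where
  "L1 c2 v = (c2 - v) / c2"

definition L2 :: "real \<Rightarrow> real \<Rightarrow> real" where
  "L2 c2 v = v / c2"

definition lag_term :: "(real \<Rightarrow> real \<Rightarrow> real) \<Rightarrow> (nat \<Rightarrow> real) \<Rightarrow> (real \<Rightarrow> real) \<Rightarrow> nat \<Rightarrow> real \<Rightarrow> real" where
  "lag_term K h z n t = (LINT s:{0..mesh_point h n}|lebesgue. K t s * z s)"

text \<open>\<open>B_coeff K c2 h L n\<close> is $B_n(2,j)$ for \<open>L\<close> the \<open>j\<close>-th Lagrange polynomial.\<close>

definition B_coeff :: "(real \<Rightarrow> real \<Rightarrow> real) \<Rightarrow> real \<Rightarrow> (nat \<Rightarrow> real) \<Rightarrow> (real \<Rightarrow> real) \<Rightarrow> nat \<Rightarrow> real" where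
  "B_coeff K c2 h L n =
     (LINT s:{0..c2}|lebesgue. K (mesh_point h n + c2 * h n) (mesh_point h n + s * h n) * L s)"

text \<open>Only the values of \<open>z\<close> on \<open>{0<..mesh_point h N}\<close> are constrained; \<open>z 0\<close> is arbitrary and
  irrelevant, as \<open>z\<close> enters the equations only under an integral. The two inequalities say that
  \<open>G\<close> is applied within its domain.\<close>

definition collocation_solution ::
  "(real \<Rightarrow> real \<Rightarrow> real) \<Rightarrow> (real \<Rightarrow> real) \<Rightarrow> real \<Rightarrow> (nat \<Rightarrow> real) \<Rightarrow> nat \<Rightarrow> (real \<Rightarrow> real) \<Rightarrow> bool" where
  "collocation_solution K G c2 h N z \<longleftrightarrow>
     (\<exists>Z1 Z2 :: nat \<Rightarrow> real. \<forall>n<N.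
        (let t1 = mesh_point h n;
             t2 = mesh_point h n + c2 * h n;
             A1 = lag_term K h z n t1;
             A2 = lag_term K h z n t2 + h n * B_coeff K c2 h (L1 c2) n * Z1 n
                                      + h n * B_coeff K c2 h (L2 c2) n * Z2 n
         in (\<forall>v\<in>{0<..1}. z (mesh_point h n + v * h n) = L1 c2 v * Z1 n + L2 c2 v * Z2 n) \<and>
            0 \<le> A1 \<and> Z1 n = G A1 \<and>
            0 \<le> A2 \<and> Z2 n = G A2))"

definition has_nontrivial_solution ::
  "(real \<Rightarrow> real \<Rightarrow> real) \<Rightarrow> (real \<Rightarrow> real) \<Rightarrow> real \<Rightarrow> (nat \<Rightarrow> real) \<Rightarrow> nat \<Rightarrow> bool" where
  "has_nontrivial_solution K G c2 h N \<longleftrightarrow>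
     (\<exists>z. collocation_solution K G c2 h N z \<and> (\<exists>s\<in>{mesh_point h 0<..mesh_point h 1}. z s \<noteq> 0))"

text \<open>The bounds $H_0, H_1, \dots$ are chosen one after the other, each depending on the step sizes
  already taken: \<open>H [h\<^sub>0, \<dots>, h\<^bsub>n-1\<^esub>]\<close> is $H_n$. The given steps $h_0, \dots, h_{n-1}$ are
  understood to have been taken within their own bounds. For \<open>c2 < 1\<close> this restriction
  cannot be dropped: \<open>L1 c2\<close> is negative on \<open>{c2<..1}\<close>, so after a step that is too large a
  nontrivial solution may become negative near $t_n$, giving $F_n(t_n) < 0$, and then it has no
  continuation at all, however small $h_n$ is.\<close>

definition existence_near_zero ::
  "(real \<Rightarrow> real \<Rightarrow> real) \<Rightarrow> (real \<Rightarrow> real) \<Rightarrow> real \<Rightarrow> bool" where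
  "existence_near_zero K G c2 \<longleftrightarrow>
     (\<exists>H :: real list \<Rightarrow> real.
        (\<forall>hs. 0 < H hs) \<and>
        (\<forall>h. 0 < h 0 \<and> h 0 \<le> H [] \<longrightarrow> has_nontrivial_solution K G c2 h 1) \<and>
        (\<forall>n\<ge>1. \<forall>h.
           (\<forall>i<n. 0 < h i \<and> h i \<le> H (map h [0..<i])) \<and> has_nontrivial_solution K G c2 h n \<longrightarrow>
           0 < h n \<and> h n \<le> H (map h [0..<n]) \<longrightarrow> has_nontrivial_solution K G c2 h (Suc n)))"

text \<open>The stronger variant in which $h_0, \dots, h_{n-1}$ are arbitrary positive steps admitting a
  nontrivial solution in $[0,t_n]$. It implies \<open>existence_near_zero\<close>.\<close>

definition existence_near_zero_any_steps ::
  "(real \<Rightarrow> real \<Rightarrow> real) \<Rightarrow> (real \<Rightarrow> real) \<Rightarrow> real \<Rightarrow> bool" where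
  "existence_near_zero_any_steps K G c2 \<longleftrightarrow>
     (\<exists>H0>0. \<forall>h. 0 < h 0 \<and> h 0 \<le> H0 \<longrightarrow> has_nontrivial_solution K G c2 h 1) \<and>
     (\<forall>n\<ge>1. \<forall>h. (\<forall>i<n. 0 < h i) \<and> has_nontrivial_solution K G c2 h n \<longrightarrow>
        (\<exists>H>0. \<forall>k. 0 < k \<and> k \<le> H \<longrightarrow> has_nontrivial_solution K G c2 (h(n := k)) (Suc n)))"

end

theory Submission
  imports Defs
begin

text \<open>Substituting $u = t_n + s h_n$ shows that $h_n B_n(2,j)$ is at most
  $\int_{t_n}^{t_{n,2}} K(t_{n,2},u)\,du$ and so tends to $0$ with $h_n$. In the first step
  $Z_{0,1} = 0$, and with $\beta = h_0 B_0(2,2) > 0$ a nontrivial $Z_{0,2}$ amounts to a $y > 0$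
  with $G(y)/y = 1/\beta$. As $1/\beta$ becomes arbitrarily large, $G(y)/y$ must be unbounded;
  conversely, unboundedness solves the equation for all small $h_0$ by the intermediate value
  theorem. Later steps are fixed point equations $y = \alpha + \beta G(y)$ with $\alpha \ge 0$
  bounded and $\beta$ small, solvable for any $G$, provided the solution so far is nonnegative. For
  $c_2 = 1$ this is automatic. For $c_2 < 1$ the new linear piece is nonnegative as soon as
  $Z_{n,2} \ge (1 - c_2) Z_{n,1}$, which holds for small $h_n$ because, by Fatou's lemma and
  continuity of $K(\cdot,s)$, $F_n$ is lower semicontinuous from the right at $t_n$.\<close>

section \<open>Weighted integrals: change of variables, integrability and bounds\<close>

lemma LINT_rescale:
  fixes f L :: "real \<Rightarrow> real"
  assumes "0 < k"
  shows "k * (LINT s:{0..c}|lebesgue. f (a + s * k) * L s) =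
         (LINT u:{a..a + c * k}|lebesgue. f u * L ((u - a) / k))"
proof -
  have "(\<integral>x. indicator {a..a + c * k} x *\<^sub>R (f x * L ((x - a) / k)) \<partial>lebesgue) =
        \<bar>k\<bar> *\<^sub>R (\<integral>x. indicator {a..a + c * k} (a + k * x) *\<^sub>R (f (a + k * x) * L ((a + k * x - a) / k)) \<partial>lebesgue)"
    using assms by (intro lebesgue_integral_real_affine) auto
  also have "(\<lambda>x. indicator {a..a + c * k} (a + k * x) *\<^sub>R (f (a + k * x) * L ((a + k * x - a) / k))) =
             (\<lambda>x. indicator {0..c} x *\<^sub>R (f (a + x * k) * L x))"
    using assms by (auto simp: indicator_def fun_eq_iff mult.commute zero_le_mult_iff)
  finally show ?thesis
    using assms by (simp add: set_lebesgue_integral_def)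
qed

lemma set_integral_nonneg_real:
  fixes f :: "'a \<Rightarrow> real"
  assumes "\<And>x. x \<in> A \<Longrightarrow> 0 \<le> f x"
  shows "0 \<le> (LINT x:A|M. f x)"
  unfolding set_lebesgue_integral_def
  using assms by (intro integral_nonneg_AE AE_I2) (auto simp: indicator_def)

lemma set_integrable_mult_bounded:
  fixes f g :: "real \<Rightarrow> real"
  assumes f: "set_integrable lebesgue A f"
    and g: "g \<in> borel_measurable borel"
    and M: "\<And>x. x \<in> A \<Longrightarrow> \<bar>g x\<bar> \<le> M"
  shows "set_integrable lebesgue A (\<lambda>x. f x * g x)"
proof (rule set_integrable_bound)
  show "set_integrable lebesgue A (\<lambda>x. f x * M)"
    using f by simp
  \<comment> \<open>Integrability over \<open>A\<close> gives measurability of this product only,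
    not of \<open>f\<close>, so the indicator stays attached to \<open>f\<close>.\<close>
  have [measurable]: "(\<lambda>x. indicator A x * f x) \<in> borel_measurable lebesgue"
    using f by (auto simp: set_integrable_def)
  have [measurable]: "g \<in> borel_measurable lebesgue"
    using g by (simp add: measurable_completion)
  have "(\<lambda>x. (indicator A x * f x) * g x) \<in> borel_measurable lebesgue"
    by measurable
  then show "set_borel_measurable lebesgue A (\<lambda>x. f x * g x)"
    by (simp add: set_borel_measurable_def mult.assoc)
  show "AE x in lebesgue. x \<in> A \<longrightarrow> norm (f x * g x) \<le> norm (f x * M)"
    using M by (auto simp: abs_mult intro!: mult_left_mono order_trans[OF M abs_ge_self])
qed

lemma set_integral_mult_bounds:
  fixes f g :: "real \<Rightarrow> real"
  assumes f: "set_integrable lebesgue A f" "\<And>x. x \<in> A \<Longrightarrow> 0 \<le> f x"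
    and g: "g \<in> borel_measurable borel" "\<And>x. x \<in> A \<Longrightarrow> 0 \<le> g x" "\<And>x. x \<in> A \<Longrightarrow> g x \<le> M"
  shows "0 \<le> (LINT x:A|lebesgue. f x * g x)"
    and "(LINT x:A|lebesgue. f x * g x) \<le> M * (LINT x:A|lebesgue. f x)"
proof -
  show "0 \<le> (LINT x:A|lebesgue. f x * g x)"
    using f g by (intro set_integral_nonneg_real) auto
  have "(LINT x:A|lebesgue. f x * g x) \<le> (LINT x:A|lebesgue. f x * M)"
  proof (rule set_integral_mono)
    show "set_integrable lebesgue A (\<lambda>x. f x * g x)"
      using f g by (intro set_integrable_mult_bounded[where M = M]) auto
  qed (use f g in \<open>auto intro: mult_left_mono\<close>)
  then show "(LINT x:A|lebesgue. f x * g x) \<le> M * (LINT x:A|lebesgue. f x)"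
    by (simp add: mult.commute)
qed

section \<open>Consequences of the conditions on the kernel and the nonlinearity\<close>

locale collocation_problem =
  fixes K :: "real \<Rightarrow> real \<Rightarrow> real" and G :: "real \<Rightarrow> real" and c2 :: real
  assumes kernel: "kernel_conditions K"
    and nonlinearity: "nonlinearity_conditions G"
    and c2: "0 < c2" "c2 \<le> 1"
begin

definition cumul :: "real \<Rightarrow> real" where
  "cumul t = (LINT s:{0..t}|lebesgue. K t s)"

lemma K_nonneg: "0 \<le> K t s"
  using kernel by (auto simp: kernel_conditions_def)

lemma K_integrable:
  assumes "0 < t"
  shows "set_integrable lebesgue {a..b} (K t)"
  using kernel assms by (auto simp: kernel_conditions_def)

lemma cumul_strict_mono: "0 \<le> s \<Longrightarrow> s < t \<Longrightarrow> cumul s < cumul t"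
  using kernel by (auto simp: kernel_conditions_def cumul_def strict_mono_on_def)

lemma cumul_pos: "0 < t \<Longrightarrow> 0 < cumul t"
  using cumul_strict_mono[of 0 t] set_integral_nonneg_real[of "{0..0}" "K 0" lebesgue] K_nonneg
  by (auto simp: cumul_def)

lemma tail_tendsto_0:
  "0 \<le> a \<Longrightarrow> ((\<lambda>t. LINT s:{a..t}|lebesgue. K t s) \<longlongrightarrow> 0) (at_right a)"
  using kernel by (auto simp: kernel_conditions_def)

lemma G_nonneg: "0 \<le> y \<Longrightarrow> 0 \<le> G y"
  and G_0: "G 0 = 0"
  and G_cont: "continuous_on {0..} G"
  and G_less: "0 \<le> x \<Longrightarrow> x < y \<Longrightarrow> G x < G y"
  using nonlinearity by (auto simp: nonlinearity_conditions_def strict_mono_on_def)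

lemma G_le: "0 \<le> x \<Longrightarrow> x \<le> y \<Longrightarrow> G x \<le> G y"
  using G_less[of x y] by (cases "x = y") auto

lemma G_pos: "0 < y \<Longrightarrow> 0 < G y"
  using G_less[of 0 y] G_0 by simp

section \<open>The coefficients of the collocation equations for small steps\<close>

text \<open>\<open>coeff t\<^sub>n (L\<^sub>j) h\<^sub>n\<close> is $h_n B_n(2,j)$.\<close>

definition coeff :: "real \<Rightarrow> (real \<Rightarrow> real) \<Rightarrow> real \<Rightarrow> real" where
  "coeff a L k = k * (LINT s:{0..c2}|lebesgue. K (a + c2 * k) (a + s * k) * L s)"

lemma coeff_eq:
  assumes "0 < k"
  shows "coeff a L k = (LINT u:{a..a + c2 * k}|lebesgue. K (a + c2 * k) u * L ((u - a) / k))"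
  unfolding coeff_def using assms by (rule LINT_rescale)

text \<open>For u in [a, a + c2 k] the point (u - a)/k lies in [0, c2], so the weight lies in
  [0, 1]. The upper bound is the tail integral whose limit at \<open>a\<close> the kernel conditions
  prescribe.\<close>

lemma coeff_bounds:
  assumes L: "L \<in> borel_measurable borel" "\<And>s. 0 \<le> s \<Longrightarrow> s \<le> c2 \<Longrightarrow> 0 \<le> L s \<and> L s \<le> 1"
    and "0 < k" "0 \<le> a"
  shows "0 \<le> coeff a L k"
    and "coeff a L k \<le> (LINT u:{a..a + c2 * k}|lebesgue. K (a + c2 * k) u)"
proof -
  have "0 < a + c2 * k"
    using assms c2 by (simp add: add_nonneg_pos)
  then have *: "set_integrable lebesgue {a..a + c2 * k} (K (a + c2 * k))"
    by (rule K_integrable)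
  have [measurable]: "L \<in> borel_measurable borel" by fact
  have "(\<lambda>u. L ((u - a) / k)) \<in> borel_measurable borel" by measurable
  moreover have "0 \<le> L ((u - a) / k) \<and> L ((u - a) / k) \<le> 1" if "u \<in> {a..a + c2 * k}" for u
    using that \<open>0 < k\<close> by (intro L(2)) (auto simp: field_simps)
  ultimately show "0 \<le> coeff a L k"
      "coeff a L k \<le> (LINT u:{a..a + c2 * k}|lebesgue. K (a + c2 * k) u)"
    unfolding coeff_eq[OF \<open>0 < k\<close>]
    using set_integral_mult_bounds[OF *, of "\<lambda>u. L ((u - a) / k)" 1] K_nonneg by auto
qed

lemma L1_props: "L1 c2 \<in> borel_measurable borel" "0 \<le> s \<Longrightarrow> s \<le> c2 \<Longrightarrow> 0 \<le> L1 c2 s \<and> L1 c2 s \<le> 1"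
  unfolding L1_def using c2 by (auto simp: field_simps)

lemma L2_props: "L2 c2 \<in> borel_measurable borel" "0 \<le> s \<Longrightarrow> s \<le> c2 \<Longrightarrow> 0 \<le> L2 c2 s \<and> L2 c2 s \<le> 1"
  unfolding L2_def using c2 by (auto simp: field_simps)

text \<open>Turns statements about times close to \<open>a\<close> from the right into statements
  about small step sizes, the time being the second collocation node.\<close>

lemma filterlim_node: "filterlim (\<lambda>k. a + c2 * k) (at_right a) (at_right 0)"
  unfolding filterlim_at
proof
  show "eventually (\<lambda>k. a + c2 * k \<in> {a<..} \<and> a + c2 * k \<noteq> a) (at_right 0)"
    using eventually_at_right_less[of "0::real"] by eventually_elim (use c2 in auto)
qed (auto intro!: tendsto_eq_intros)

lemma coeff_eventually_less:
  assumes L: "L \<in> borel_measurable borel" "\<And>s. 0 \<le> s \<Longrightarrow> s \<le> c2 \<Longrightarrow> 0 \<le> L s \<and> L s \<le> 1"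
    and "0 \<le> a" "0 < e"
  shows "eventually (\<lambda>k. coeff a L k < e) (at_right 0)"
proof -
  have "eventually (\<lambda>t. (LINT s:{a..t}|lebesgue. K t s) < e) (at_right a)"
    using tail_tendsto_0[OF \<open>0 \<le> a\<close>] \<open>0 < e\<close> by (rule order_tendstoD(2))
  then have "eventually (\<lambda>k. (LINT s:{a..a + c2 * k}|lebesgue. K (a + c2 * k) s) < e) (at_right 0)"
    using filterlim_node by (rule eventually_compose_filterlim)
  moreover have "eventually (\<lambda>k::real. 0 < k) (at_right 0)"
    by (simp add: eventually_at_right_less)
  ultimately show ?thesis
    by eventually_elim (use coeff_bounds(2)[OF L _ \<open>0 \<le> a\<close>] in \<open>force\<close>)
qed

text \<open>If this integral of a nonnegative function vanished, the integrand would be 0 almost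
  everywhere. The weight is positive off u = 0, so \<open>K ?t\<close> would vanish almost
  everywhere on \<open>{0..?t}\<close>, contradicting \<open>cumul_pos\<close>.\<close>

lemma coeff_L2_pos:
  assumes "0 < k"
  shows "0 < coeff 0 (L2 c2) k"
proof -
  let ?t = "c2 * k"
  let ?f = "\<lambda>u. K ?t u * L2 c2 (u / k)"
  have t: "0 < ?t" using assms c2 by simp
  have "coeff 0 (L2 c2) k \<noteq> 0"
  proof
    assume "coeff 0 (L2 c2) k = 0"
    then have eq: "(\<integral>u. indicator {0..?t} u *\<^sub>R ?f u \<partial>lebesgue) = 0"
      using coeff_eq[OF assms, of 0 "L2 c2"] by (simp add: set_lebesgue_integral_def)
    have "set_integrable lebesgue {0..?t} ?f"
    proof (rule set_integrable_mult_bounded[where M = 1])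
      show "set_integrable lebesgue {0..?t} (K ?t)"
        using t by (rule K_integrable)
      show "(\<lambda>u. L2 c2 (u / k)) \<in> borel_measurable borel"
        unfolding L2_def by measurable
    qed (use assms c2 in \<open>auto simp: L2_def field_simps abs_le_iff\<close>)
    then have int: "integrable lebesgue (\<lambda>u. indicator {0..?t} u *\<^sub>R ?f u)"
      by (simp add: set_integrable_def)
    have nonneg: "AE u in lebesgue. 0 \<le> indicator {0..?t} u *\<^sub>R ?f u"
      using K_nonneg assms c2 by (intro AE_I2) (auto simp: indicator_def L2_def)
    have "AE u in lebesgue. indicator {0..?t} u *\<^sub>R ?f u = 0"
      using integral_nonneg_eq_0_iff_AE[OF int nonneg] eq by simp
    moreover have "AE u in lebesgue. u \<noteq> (0::real)"
      by (simp add: AE_completion AE_lborel_singleton)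
    ultimately have "AE u in lebesgue. indicator {0..?t} u *\<^sub>R K ?t u = 0"
      by eventually_elim (use assms c2 in \<open>auto simp: indicator_def L2_def split: if_splits\<close>)
    then have "cumul ?t = 0"
      unfolding cumul_def set_lebesgue_integral_def by (rule integral_eq_zero_AE)
    with cumul_pos[OF t] show False by simp
  qed
  moreover have "0 \<le> coeff 0 (L2 c2) k"
    using coeff_bounds(1)[OF L2_props assms] by simp
  ultimately show ?thesis by simp
qed

section \<open>The scalar equations behind a collocation step\<close>

text \<open>Intermediate value theorem on [\<alpha>, R + 1]: the difference of the two sides is at
  most 0 at \<alpha>, and at R + 1 it is at least R + 1 - \<alpha> - 1, hence nonnegative.\<close>

lemma fixed_point_exists:
  assumes "0 \<le> \<alpha>" "0 \<le> \<beta>" "\<alpha> \<le> R" "\<beta> * G (R + 1) \<le> 1"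
  obtains y where "\<alpha> \<le> y" "y = \<alpha> + \<beta> * G y"
proof -
  have "\<exists>y\<ge>\<alpha>. y \<le> R + 1 \<and> y - (\<alpha> + \<beta> * G y) = 0"
  proof (rule IVT')
    show "\<alpha> - (\<alpha> + \<beta> * G \<alpha>) \<le> 0"
      using assms G_nonneg by simp
    show "continuous_on {\<alpha>..R + 1} (\<lambda>y. y - (\<alpha> + \<beta> * G y))"
      by (intro continuous_intros continuous_on_subset[OF G_cont]) (use assms in auto)
  qed (use assms in auto)
  then show ?thesis
    using that by auto
qed

text \<open>The image of the ratio is connected. It contains \<open>G 1\<close>, the ratio at y = 1,
  and a value above \<open>c\<close>, since a nonnegative unbounded ratio is unbounded
  above.\<close>

lemma ratio_eventually_attained:
  assumes "\<not> bounded ((\<lambda>y. G y / y) ` {0<..})" and "G 1 \<le> c"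
  obtains y where "0 < y" "G y = c * y"
proof -
  have "\<exists>y>0. c < G y / y"
  proof (rule ccontr)
    assume "\<not> ?thesis"
    then have "\<forall>x\<in>(\<lambda>y. G y / y) ` {0<..}. norm x \<le> c"
      using G_nonneg by (force simp: abs_le_iff intro: order_trans[of "- _" 0])
    then show False
      using assms(1) bounded_iff by blast
  qed
  then obtain y1 where y1: "0 < y1" "c < G y1 / y1" by blast
  have "connected ((\<lambda>y. G y / y) ` {0<..})"
    by (intro connected_continuous_image continuous_intros continuous_on_subset[OF G_cont]) auto
  moreover have "G 1 \<in> (\<lambda>y. G y / y) ` {0<..}" "G y1 / y1 \<in> (\<lambda>y. G y / y) ` {0<..}"
    using y1 by (auto intro: image_eqI[where x = 1])
  ultimately have "{G 1..G y1 / y1} \<subseteq> (\<lambda>y. G y / y) ` {0<..}"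
    by (rule connected_contains_Icc)
  moreover have "c \<in> {G 1..G y1 / y1}"
    using y1 assms(2) by simp
  ultimately have "c \<in> (\<lambda>y. G y / y) ` {0<..}" by blast
  then show ?thesis
    using that by (auto simp: field_simps)
qed


section \<open>The lag term and its behaviour just after a mesh point\<close>

lemma lag_integral:
  assumes "0 < t" "z \<in> borel_measurable borel" "\<And>s. 0 \<le> z s" "\<And>s. z s \<le> M"
  shows "set_integrable lebesgue {0..a} (\<lambda>s. K t s * z s)"
    and "0 \<le> (LINT s:{0..a}|lebesgue. K t s * z s)"
    and "(LINT s:{0..a}|lebesgue. K t s * z s) \<le> M * (LINT s:{0..a}|lebesgue. K t s)"
proof -
  note K = K_integrable[OF assms(1), of 0 a]
  show "set_integrable lebesgue {0..a} (\<lambda>s. K t s * z s)"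
    using assms K by (intro set_integrable_mult_bounded[where M = M]) auto
  show "0 \<le> (LINT s:{0..a}|lebesgue. K t s * z s)"
    by (rule set_integral_mult_bounds(1)[OF K, where M = M]) (use assms K_nonneg in auto)
  show "(LINT s:{0..a}|lebesgue. K t s * z s) \<le> M * (LINT s:{0..a}|lebesgue. K t s)"
    by (rule set_integral_mult_bounds(2)[OF K]) (use assms K_nonneg in auto)
qed

text \<open>Fatou's lemma along sequences decreasing to \<open>a\<close>: the domain of integration
  is fixed and only the first argument of \<open>K\<close> moves. No dominating function is at hand,
  so only a lower bound results.\<close>

lemma lag_lower_semicontinuous:
  assumes a: "0 < a" "a < \<epsilon>"
    and cont: "\<And>s. 0 \<le> s \<Longrightarrow> s < \<epsilon> \<Longrightarrow> continuous_on {s<..<\<epsilon>} (\<lambda>t. K t s)"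
    and z: "z \<in> borel_measurable borel" "\<And>s. 0 \<le> z s" "\<And>s. z s \<le> M"
    and x: "x < (LINT s:{0..a}|lebesgue. K a s * z s)"
  shows "eventually (\<lambda>t. x < (LINT s:{0..a}|lebesgue. K t s * z s)) (at_right a)"
proof -
  define f where "f t s = indicator {0..a} s *\<^sub>R (K t s * z s)" for t s
  define F where "F t = (LINT s:{0..a}|lebesgue. K t s * z s)" for t
  have f_nonneg: "0 \<le> f t s" for t s
    using z K_nonneg by (auto simp: f_def)
  have f_int: "integrable lebesgue (f t)" if "0 < t" for t
    using lag_integral(1)[OF that z, of a] by (simp add: set_integrable_def f_def[abs_def])
  have F: "ennreal (F t) = (\<integral>\<^sup>+s. ennreal (f t s) \<partial>lebesgue)" if "0 < t" for t
    using nn_integral_eq_integral[OF f_int[OF that]] f_nonneg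
    by (simp add: F_def f_def[abs_def] set_lebesgue_integral_def)
  have "eventually (\<lambda>t. x < F t) (at_right a)"
  proof (rule sequentially_imp_eventually_at_right[OF a(2)])
    fix X :: "nat \<Rightarrow> real"
    assume X: "\<And>n. a < X n" "\<And>n. X n < \<epsilon>" "X \<longlonglongrightarrow> a"
    have X_pos: "0 < X n" for n
      using X(1)[of n] a by simp
    show "eventually (\<lambda>n. x < F (X n)) sequentially"
    \<comment> \<open>The passage to \<open>ennreal\<close> identifies all negative numbers with 0,
      so \<open>ennreal x < ennreal (F a)\<close> needs \<open>F a\<close> positive. If
      \<open>F a = 0\<close>, then x is negative and the claim follows from nonnegativity.\<close>
    proof (cases "F a = 0")
      case True
      have "0 \<le> F (X n)" for n
        unfolding F_def by (rule lag_integral(2)[OF X_pos z])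
      with True x show ?thesis
        by (intro always_eventually) (auto simp: F_def intro: less_le_trans)
    next
      case False
      then have "0 < F a"
        using lag_integral(2)[OF a(1) z, of a] by (simp add: F_def)
      have meas: "(\<lambda>s. ennreal (f (X n) s)) \<in> borel_measurable lebesgue" for n
        using borel_measurable_integrable[OF f_int[OF X_pos[of n]]] by measurable
      \<comment> \<open>Continuity of the kernel in its first argument is given only beyond the
        diagonal, so it holds at \<open>a\<close> for s < a; the point s = a is a null set.\<close>
      have lim: "ennreal (f a s) = liminf (\<lambda>n. ennreal (f (X n) s))" if "s \<noteq> a" for s
      proof (cases "s \<in> {0..a}")
        case True
        with that a have s: "0 \<le> s" "s < a" by auto
        then have "isCont (\<lambda>t. K t s) a"
          using cont[of s] a by (simp add: continuous_on_eq_continuous_at)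
        then have "(\<lambda>n. K (X n) s) \<longlonglongrightarrow> K a s"
          using X(3) by (rule isCont_tendsto_compose)
        then have "(\<lambda>n. ennreal (f (X n) s)) \<longlonglongrightarrow> ennreal (f a s)"
          unfolding f_def by (intro tendsto_intros)
        then show ?thesis
          by (intro lim_imp_Liminf[symmetric]) auto
      qed (simp add: f_def Liminf_const)
      have "AE s in lebesgue. s \<noteq> a"
        by (simp add: AE_completion AE_lborel_singleton)
      then have "ennreal (F a) = (\<integral>\<^sup>+s. liminf (\<lambda>n. ennreal (f (X n) s)) \<partial>lebesgue)"
        unfolding F[OF a(1)] by (intro nn_integral_cong_AE) (auto elim!: eventually_mono intro: lim)
      also have "\<dots> \<le> liminf (\<lambda>n. \<integral>\<^sup>+s. ennreal (f (X n) s) \<partial>lebesgue)"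
        by (rule nn_integral_liminf[OF meas])
      also have "\<dots> = liminf (\<lambda>n. ennreal (F (X n)))"
        using F[OF X_pos] by simp
      finally have "ennreal x < liminf (\<lambda>n. ennreal (F (X n)))"
        using ennreal_lessI[OF \<open>0 < F a\<close>, of x] x by (simp add: F_def)
      then have "eventually (\<lambda>n. ennreal x < ennreal (F (X n))) sequentially"
        by (rule less_LiminfD)
      then show ?thesis
        by eventually_elim (meson ennreal_leI linorder_not_le)
    qed
  qed
  then show ?thesis by (simp add: F_def)
qed

text \<open>The two alternatives of the theorem, localized at a mesh point: \<epsilon> lies beyond
  \<open>a\<close>, so that \<open>\<lambda>t. K t s\<close> is continuous at \<open>a\<close>
  whenever 0 \<le> s < a.\<close>

definition continuable :: "real \<Rightarrow> bool" where
  "continuable a \<longleftrightarrow> c2 = 1 \<or>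
     (\<exists>\<epsilon>>a. \<forall>s. 0 \<le> s \<and> s < \<epsilon> \<longrightarrow> continuous_on {s<..<\<epsilon>} (\<lambda>t. K t s))"

lemma continuable_if_c2_eq_1: "c2 = 1 \<Longrightarrow> continuable a"
  unfolding continuable_def by (rule disjI1)

text \<open>The factor 1 - c2 < 1 leaves room below \<open>G (F a)\<close>: the left-hand side
  equals \<open>G x\<close> for some x < F a, and lower semicontinuity keeps the lag term above x.
  If c2 = 1 or \<open>F a = 0\<close>, the left-hand side is 0.\<close>

lemma G_lag_lower_bound:
  assumes a: "0 < a" "continuable a"
    and z: "z \<in> borel_measurable borel" "\<And>s. 0 \<le> z s" "\<And>s. z s \<le> M"
  shows "eventually (\<lambda>t. (1 - c2) * G (LINT s:{0..a}|lebesgue. K a s * z s)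
           \<le> G (LINT s:{0..a}|lebesgue. K t s * z s)) (at_right a)"
proof -
  define F where "F t = (LINT s:{0..a}|lebesgue. K t s * z s)" for t
  have F_nonneg: "0 \<le> F t" if "0 < t" for t
    unfolding F_def by (rule lag_integral(2)[OF that z])
  have after: "eventually (\<lambda>t. a < t) (at_right a)"
    by (rule eventually_at_right_less)
  have "eventually (\<lambda>t. (1 - c2) * G (F a) \<le> G (F t)) (at_right a)"
  proof (cases "c2 = 1 \<or> F a = 0")
    case True
    show ?thesis
      using after by eventually_elim (use True G_0 G_nonneg F_nonneg a in auto)
  next
    case False
    then have Fa: "0 < F a" using F_nonneg[OF a(1)] by simp
    have "\<exists>x\<ge>0. x \<le> F a \<and> G x = (1 - c2) * G (F a)"
    proof (rule IVT')
      show "G 0 \<le> (1 - c2) * G (F a)" "(1 - c2) * G (F a) \<le> G (F a)"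
        using c2 G_pos[OF Fa] by (auto simp: G_0 mult_le_cancel_right1)
    qed (use Fa in \<open>auto intro: continuous_on_subset[OF G_cont]\<close>)
    then obtain x where x: "0 \<le> x" "x \<le> F a" "G x = (1 - c2) * G (F a)" by blast
    have "x \<noteq> F a"
      using x(3) c2 G_pos[OF Fa] by auto
    with x have "x < F a" by simp
    obtain \<epsilon> where "a < \<epsilon>" "\<And>s. 0 \<le> s \<Longrightarrow> s < \<epsilon> \<Longrightarrow> continuous_on {s<..<\<epsilon>} (\<lambda>t. K t s)"
      using a(2) False by (auto simp: continuable_def)
    then have "eventually (\<lambda>t. x < F t) (at_right a)"
      using lag_lower_semicontinuous[OF a(1) _ _ z, of \<epsilon> x] \<open>x < F a\<close> by (simp add: F_def)
    then show ?thesis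
      by eventually_elim (use x G_le in \<open>metis less_imp_le\<close>)
  qed
  then show ?thesis by (simp add: F_def)
qed

section \<open>Solving the stage equations for small steps\<close>

text \<open>The fixed point satisfies y \<ge> \<alpha> \<ge> F(a + c2 k), so monotonicity of
  \<open>G\<close> carries the lower bound for the lag term over to \<open>G y\<close>. The last
  conjunct is what keeps the new linear piece nonnegative.\<close>

lemma stage_solvable:
  assumes a: "0 < a" "continuable a"
    and z: "z \<in> borel_measurable borel" "\<And>s. 0 \<le> z s" "\<And>s. z s \<le> M"
    and Z1: "Z1 = G (LINT s:{0..a}|lebesgue. K a s * z s)"
  shows "eventually (\<lambda>k. \<exists>y\<ge>0.
           y = (LINT s:{0..a}|lebesgue. K (a + c2 * k) s * z s) + coeff a (L1 c2) k * Z1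
                 + coeff a (L2 c2) k * G y \<and>
           (1 - c2) * Z1 \<le> G y) (at_right 0)"
proof -
  define F where "F t = (LINT s:{0..a}|lebesgue. K t s * z s)" for t
  \<comment> \<open>Bounds \<alpha> for all small k at once: k < 1 keeps the node below a + 1, and
    \<open>coeff a (L1 c2) k < 1\<close> bounds the second summand by \<open>Z1\<close>.\<close>
  define R where "R = M * cumul (a + 1) + Z1"
  have Z1_nonneg: "0 \<le> Z1"
    unfolding Z1 using lag_integral(2)[OF a(1) z] by (rule G_nonneg)
  have M: "0 \<le> M" using z(2,3)[of 0] by linarith
  have "0 \<le> R"
    using cumul_pos[of "a + 1"] a M Z1_nonneg by (simp add: R_def)
  then have GR: "0 < G (R + 1)" by (intro G_pos) simp
  have "eventually (\<lambda>t. (1 - c2) * Z1 \<le> G (F t)) (at_right a)"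
    unfolding Z1 F_def by (rule G_lag_lower_bound[OF a z])
  then have "eventually (\<lambda>k. (1 - c2) * Z1 \<le> G (F (a + c2 * k))) (at_right 0)"
    using filterlim_node by (rule eventually_compose_filterlim)
  moreover have "eventually (\<lambda>k. coeff a (L1 c2) k < 1) (at_right 0)"
    using a by (intro coeff_eventually_less[OF L1_props]) auto
  moreover have "eventually (\<lambda>k. coeff a (L2 c2) k < 1 / G (R + 1)) (at_right 0)"
    using a GR by (intro coeff_eventually_less[OF L2_props]) auto
  moreover have "eventually (\<lambda>k::real. 0 < k) (at_right 0)"
    by (rule eventually_at_right_less)
  moreover have "eventually (\<lambda>k::real. k < 1) (at_right 0)"
    by (rule order_tendstoD(2)[OF tendsto_ident_at]) simp
  ultimately show ?thesis
  proof eventually_elim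
    case (elim k)
    let ?t = "a + c2 * k"
    let ?\<alpha> = "F ?t + coeff a (L1 c2) k * Z1" and ?\<beta> = "coeff a (L2 c2) k"
    have t: "0 < ?t" "a < ?t" "?t < a + 1"
      using a c2 elim mult_le_less_imp_less[of c2 1 k 1] by (auto simp: add_pos_pos)
    have F_nonneg: "0 \<le> F ?t"
      unfolding F_def by (rule lag_integral(2)[OF t(1) z])
    have "(LINT s:{0..a}|lebesgue. K ?t s) \<le> cumul ?t"
      unfolding cumul_def set_lebesgue_integral_def
      using K_integrable[OF t(1)] t(2) K_nonneg
      by (intro integral_mono) (auto simp: set_integrable_def indicator_def)
    also have "\<dots> \<le> cumul (a + 1)"
      using cumul_strict_mono[of ?t "a + 1"] t by simp
    finally have "M * (LINT s:{0..a}|lebesgue. K ?t s) \<le> M * cumul (a + 1)"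
      using M by (rule mult_left_mono)
    with lag_integral(3)[OF t(1) z, of a] have "F ?t \<le> M * cumul (a + 1)"
      by (simp add: F_def)
    moreover have "coeff a (L1 c2) k * Z1 \<le> Z1" "0 \<le> coeff a (L1 c2) k * Z1"
      using elim Z1_nonneg coeff_bounds(1)[OF L1_props, of k a] a
      by (auto simp: mult_left_le_one_le)
    ultimately have \<alpha>: "F ?t \<le> ?\<alpha>" "?\<alpha> \<le> R" by (auto simp: R_def)
    have \<beta>: "0 \<le> ?\<beta>" "?\<beta> * G (R + 1) \<le> 1"
      using elim GR coeff_bounds(1)[OF L2_props, of k a] a by (auto simp: field_simps)
    obtain y where y: "?\<alpha> \<le> y" "y = ?\<alpha> + ?\<beta> * G y"
      using fixed_point_exists[of ?\<alpha> ?\<beta> R] \<alpha> \<beta> F_nonneg by auto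
    have "G (F ?t) \<le> G y"
      using F_nonneg \<alpha> y by (intro G_le) auto
    with elim y F_nonneg \<alpha> show ?case
      by (intro exI[of _ y]) (auto simp: F_def)
  qed
qed

text \<open>With \<alpha> = 0 the general fixed point argument may return only y = 0. A positive y
  comes from the ratio G(y)/y attaining 1/\<beta>, which is at least \<open>G 1\<close> once \<beta>
  is small.\<close>

lemma first_stage_solvable:
  assumes "\<not> bounded ((\<lambda>y. G y / y) ` {0<..})"
  shows "eventually (\<lambda>k. \<exists>y>0. y = coeff 0 (L2 c2) k * G y) (at_right 0)"
proof -
  have "0 < G 1" by (rule G_pos) simp
  then have "eventually (\<lambda>k. coeff 0 (L2 c2) k < 1 / G 1) (at_right 0)"
    by (intro coeff_eventually_less[OF L2_props]) auto
  moreover have "eventually (\<lambda>k::real. 0 < k) (at_right 0)"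
    by (rule eventually_at_right_less)
  ultimately show ?thesis
  proof eventually_elim
    case (elim k)
    have \<beta>: "0 < coeff 0 (L2 c2) k" by (rule coeff_L2_pos[OF elim(2)])
    with elim \<open>0 < G 1\<close> have "G 1 \<le> 1 / coeff 0 (L2 c2) k" by (simp add: field_simps)
    then obtain y where "0 < y" "G y = 1 / coeff 0 (L2 c2) k * y"
      by (rule ratio_eventually_attained[OF assms])
    with \<beta> show ?case
      by (intro exI[of _ y]) simp
  qed
qed

section \<open>Single steps and the locality of collocation solutions\<close>

text \<open>Each step's equations involve only its own two coefficients, taken here as plain reals;
  they can therefore be chosen step by step, which \<open>collocation_solution_iff\<close>
  exploits.\<close>

definition step_ok :: "(nat \<Rightarrow> real) \<Rightarrow> (real \<Rightarrow> real) \<Rightarrow> nat \<Rightarrow> real \<Rightarrow> real \<Rightarrow> bool" where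
  "step_ok h z n Z1 Z2 \<longleftrightarrow>
     (let a = mesh_point h n; k = h n;
          A1 = lag_term K h z n a;
          A2 = lag_term K h z n (a + c2 * k) + coeff a (L1 c2) k * Z1 + coeff a (L2 c2) k * Z2
      in (\<forall>v\<in>{0<..1}. z (a + v * k) = L1 c2 v * Z1 + L2 c2 v * Z2) \<and>
         0 \<le> A1 \<and> Z1 = G A1 \<and> 0 \<le> A2 \<and> Z2 = G A2)"

lemma collocation_solution_iff:
  "collocation_solution K G c2 h N z \<longleftrightarrow> (\<forall>n<N. \<exists>Z1 Z2. step_ok h z n Z1 Z2)"
proof -
  have "collocation_solution K G c2 h N z \<longleftrightarrow> (\<exists>Z1 Z2. \<forall>n<N. step_ok h z n (Z1 n) (Z2 n))"
    by (simp add: collocation_solution_def step_ok_def coeff_def B_coeff_def Let_def)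
  also have "\<dots> \<longleftrightarrow> (\<forall>n<N. \<exists>Z1 Z2. step_ok h z n Z1 Z2)"
    by metis
  finally show ?thesis .
qed

lemma mesh_point_Suc: "mesh_point h (Suc n) = mesh_point h n + h n"
  by (simp add: mesh_point_def)

lemma mesh_point_cong: "(\<And>i. i < n \<Longrightarrow> h i = h' i) \<Longrightarrow> mesh_point h n = mesh_point h' n"
  by (simp add: mesh_point_def)

lemma mesh_point_mono: "(\<And>i. i < n \<Longrightarrow> 0 < h i) \<Longrightarrow> m \<le> n \<Longrightarrow> mesh_point h m \<le> mesh_point h n"
  unfolding mesh_point_def by (intro sum_mono2) (auto intro: less_imp_le)

lemma mesh_point_pos: "(\<And>i. i < n \<Longrightarrow> 0 < h i) \<Longrightarrow> 0 < n \<Longrightarrow> 0 < mesh_point h n"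
  unfolding mesh_point_def by (intro sum_pos) auto

lemma mesh_point_ge_first: "(\<And>i. i < n \<Longrightarrow> 0 < h i) \<Longrightarrow> 0 < n \<Longrightarrow> h 0 \<le> mesh_point h n"
  using mesh_point_mono[of n h 1] by (simp add: mesh_point_def)

text \<open>The value at 0 is left open by collocation; removing the null set \<open>{0}\<close>
  from the domain makes agreement on the half-open interval enough.\<close>

lemma lag_term_cong:
  assumes "mesh_point h n = mesh_point h' n"
    and "\<And>s. 0 < s \<Longrightarrow> s \<le> mesh_point h n \<Longrightarrow> z s = z' s"
  shows "lag_term K h z n t = lag_term K h' z' n t"
proof -
  have "lag_term K g w n t = (LINT s:{0<..mesh_point g n}|lebesgue. K t s * w s)" for g w
    unfolding lag_term_def by (rule set_integral_discrete_difference[where X = "{0}"]) auto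
  moreover have "(LINT s:{0<..mesh_point h n}|lebesgue. K t s * z s) =
        (LINT s:{0<..mesh_point h n}|lebesgue. K t s * z' s)"
    by (intro set_lebesgue_integral_cong) (use assms in auto)
  ultimately show ?thesis
    using assms(1) by simp
qed

lemma step_ok_cong:
  assumes h: "\<And>i. i \<le> n \<Longrightarrow> 0 < h i" "\<And>i. i \<le> n \<Longrightarrow> h i = h' i"
    and z: "\<And>s. 0 < s \<Longrightarrow> s \<le> mesh_point h (Suc n) \<Longrightarrow> z s = z' s"
  shows "step_ok h z n Z1 Z2 \<longleftrightarrow> step_ok h' z' n Z1 Z2"
proof -
  have mesh: "mesh_point h n = mesh_point h' n"
    by (rule mesh_point_cong) (use h in auto)
  have le: "mesh_point h n \<le> mesh_point h (Suc n)"
    by (rule mesh_point_mono) (use h in auto)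
  have a: "0 \<le> mesh_point h n"
    using mesh_point_mono[of n h 0] h by (simp add: mesh_point_def)
  have lag: "lag_term K h z n t = lag_term K h' z' n t" for t
    by (rule lag_term_cong) (use mesh z le in auto)
  have "z (mesh_point h n + v * h n) = z' (mesh_point h n + v * h n)" if "v \<in> {0<..1}" for v
    using that h(1)[of n] a
    by (intro z) (auto simp: mesh_point_Suc add_nonneg_pos mult_left_le_one_le)
  then show ?thesis
    using h(2)[of n] by (simp add: step_ok_def Let_def lag mesh cong: conj_cong)
qed

text \<open>Allows later step sizes to be changed and the function to be redefined beyond the last
  mesh point without disturbing the earlier equations.\<close>

lemma collocation_solution_cong:
  assumes h: "\<And>i. i < n \<Longrightarrow> 0 < h i" "\<And>i. i < n \<Longrightarrow> h i = h' i"
    and z: "\<And>s. 0 < s \<Longrightarrow> s \<le> mesh_point h n \<Longrightarrow> z s = z' s"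
    and sol: "collocation_solution K G c2 h n z"
  shows "collocation_solution K G c2 h' n z'"
proof -
  have "step_ok h z m Z1 Z2 \<longleftrightarrow> step_ok h' z' m Z1 Z2" if "m < n" for m Z1 Z2
    using that mesh_point_mono[of n h "Suc m"] h by (intro step_ok_cong h z) fastforce+
  with sol show ?thesis
    by (auto simp: collocation_solution_iff)
qed

section \<open>Extending nonnegative solutions by one step\<close>

text \<open>The invariant carried from step to step. A bare solution is arbitrary outside the mesh
  interval and may be negative inside; measurability, nonnegativity and boundedness are what
  \<open>lag_integral\<close> asks for.\<close>

definition extendable :: "(nat \<Rightarrow> real) \<Rightarrow> nat \<Rightarrow> bool" where
  "extendable h n \<longleftrightarrow>
     (\<exists>z. collocation_solution K G c2 h n z \<and> z \<in> borel_measurable borel \<and>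
          (\<exists>M. \<forall>s. 0 \<le> z s \<and> z s \<le> M) \<and> (\<exists>s. 0 < s \<and> s \<le> h 0 \<and> z s \<noteq> 0))"

lemma has_nontrivial_solution_iff:
  "has_nontrivial_solution K G c2 h n \<longleftrightarrow>
     (\<exists>z. collocation_solution K G c2 h n z \<and> (\<exists>s. 0 < s \<and> s \<le> h 0 \<and> z s \<noteq> 0))"
  by (simp add: has_nontrivial_solution_def mesh_point_def Bex_def conj_ac)

lemma extendable_imp_has_nontrivial_solution:
  "extendable h n \<Longrightarrow> has_nontrivial_solution K G c2 h n"
  by (auto simp: extendable_def has_nontrivial_solution_iff)

lemma extendable_cong:
  assumes "\<And>i. i < n \<Longrightarrow> 0 < h i" "\<And>i. i < n \<Longrightarrow> h i = h' i" "0 < n" "extendable h n"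
  shows "extendable h' n"
proof -
  have "h' 0 = h 0" using assms(2,3) by simp
  moreover have "collocation_solution K G c2 h' n z" if "collocation_solution K G c2 h n z" for z
    by (rule collocation_solution_cong[OF assms(1,2) _ that]) auto
  ultimately show ?thesis
    using assms(4) unfolding extendable_def by auto
qed

text \<open>The line with values \<open>Z1\<close> at v = 0 and \<open>(1 - c2) * Z1\<close> at v =
  c2 is (1 - v) Z1, which reaches 0 only at v = 1 unless \<open>Z1 = 0\<close>. Raising the value at
  c2 raises the line for all v \<ge> 0.\<close>

lemma interpolant_nonneg:
  assumes "0 \<le> v" "v \<le> 1" "0 \<le> Z1" "(1 - c2) * Z1 \<le> Z2"
  shows "0 \<le> L1 c2 v * Z1 + L2 c2 v * Z2"
proof -
  have "0 \<le> c2 * ((1 - v) * Z1)"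
    using assms c2 by simp
  also have "\<dots> = (c2 - v) * Z1 + v * ((1 - c2) * Z1)"
    by (simp add: algebra_simps)
  also have "\<dots> \<le> (c2 - v) * Z1 + v * Z2"
    using assms by (intro add_left_mono mult_left_mono) auto
  finally show ?thesis
    using c2 by (simp add: L1_def L2_def add_divide_distrib[symmetric])
qed

text \<open>Glues the new linear piece onto \<open>z\<close>. The unknown \<open>y\<close> is the
  argument of \<open>G\<close> in the second stage, so that \<open>Z2 = G y\<close>.\<close>

lemma collocation_solution_extend:
  assumes h: "\<And>i. i \<le> n \<Longrightarrow> 0 < h i"
    and sol: "collocation_solution K G c2 h n z"
    and z: "z \<in> borel_measurable borel" "\<And>s. 0 \<le> z s" "\<And>s. z s \<le> M"
    and A1: "0 \<le> lag_term K h z n (mesh_point h n)"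
    and Z1: "Z1 = G (lag_term K h z n (mesh_point h n))"
    and A2: "0 \<le> y" "y = lag_term K h z n (mesh_point h n + c2 * h n)
                + coeff (mesh_point h n) (L1 c2) (h n) * Z1 + coeff (mesh_point h n) (L2 c2) (h n) * G y"
    and Z2: "(1 - c2) * Z1 \<le> G y"
  obtains z' M' where "collocation_solution K G c2 h (Suc n) z'" "z' \<in> borel_measurable borel"
    "\<And>s. 0 \<le> z' s" "\<And>s. z' s \<le> M'" "\<And>s. s \<le> mesh_point h n \<Longrightarrow> z' s = z s"
    "\<And>v. 0 < v \<Longrightarrow> v \<le> 1 \<Longrightarrow> z' (mesh_point h n + v * h n) = L1 c2 v * Z1 + L2 c2 v * G y"
proof -
  define a where "a = mesh_point h n"
  define k where "k = h n"
  have k: "0 < k" using h[of n] by (simp add: k_def)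
  define z' where "z' s = (if a < s \<and> s \<le> a + k
     then L1 c2 ((s - a) / k) * Z1 + L2 c2 ((s - a) / k) * G y else z s)" for s
  have Z1_nonneg: "0 \<le> Z1" and Z2_nonneg: "0 \<le> G y"
    using A1 A2 G_nonneg Z1 by auto
  have old: "z' s = z s" if "s \<le> a" for s
    using that by (simp add: z'_def)
  have new: "z' (a + v * k) = L1 c2 v * Z1 + L2 c2 v * G y" if "0 < v" "v \<le> 1" for v
    using that k by (auto simp: z'_def mult_left_le_one_le)
  have lag: "lag_term K h z' n t = lag_term K h z n t" for t
    by (rule lag_term_cong) (auto simp: old a_def)
  have "collocation_solution K G c2 h n z'"
    by (rule collocation_solution_cong[OF _ _ _ sol]) (use h old in \<open>auto simp: a_def\<close>)
  moreover have "step_ok h z' n Z1 (G y)"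
    using new A1 A2 Z1 by (auto simp: step_ok_def Let_def lag a_def k_def)
  ultimately have "collocation_solution K G c2 h (Suc n) z'"
    by (auto simp: collocation_solution_iff less_Suc_eq)
  moreover have "z' \<in> borel_measurable borel"
    unfolding z'_def L1_def L2_def using z(1) by measurable
  moreover have "0 \<le> z' s" for s
  proof (cases "a < s \<and> s \<le> a + k")
    case True
    with k show ?thesis
      unfolding z'_def by (simp add: interpolant_nonneg[OF _ _ Z1_nonneg Z2])
  qed (use z(2) in \<open>auto simp: z'_def\<close>)
  \<comment> \<open>On [0, 1] the first Lagrange polynomial is at most 1 and the second at most
    1/c2.\<close>
  moreover have "z' s \<le> M + Z1 + G y / c2" for s
  proof -
    have "0 \<le> M" using z(2,3)[of 0] by linarith
    show ?thesis
    proof (cases "a < s \<and> s \<le> a + k")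
      case True
      define v where "v = (s - a) / k"
      have v: "0 < v" "v \<le> 1" using True k by (auto simp: v_def)
      have "L1 c2 v * Z1 \<le> 1 * Z1"
        using v c2 Z1_nonneg by (intro mult_right_mono) (auto simp: L1_def)
      moreover have "L2 c2 v * G y \<le> (1 / c2) * G y"
        using v c2 Z2_nonneg by (intro mult_right_mono) (auto simp: L2_def divide_right_mono)
      ultimately show ?thesis
        using True \<open>0 \<le> M\<close> by (simp add: z'_def v_def[symmetric])
    next
      case False
      have "z s \<le> M" by (rule z(3))
      moreover have "0 \<le> G y / c2" using Z2_nonneg c2 by simp
      moreover have "z' s = z s" using False by (auto simp: z'_def)
      ultimately show ?thesis using Z1_nonneg by linarith
    qed
  qed
  ultimately show ?thesis
    using that old new by (auto simp: a_def k_def)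
qed

lemma mesh_point_0: "mesh_point h 0 = 0"
  by (simp add: mesh_point_def)

lemma lag_term_0: "lag_term K h z 0 t = 0"
proof -
  have "lag_term K h z 0 t = (LINT s:{}|lebesgue. K t s * z s)"
    unfolding lag_term_def mesh_point_0
    by (rule set_integral_discrete_difference[where X = "{0}"]) auto
  then show ?thesis by (simp add: set_lebesgue_integral_def)
qed

lemma extendable_start:
  assumes "\<not> bounded ((\<lambda>y. G y / y) ` {0<..})"
  shows "\<exists>H>0. \<forall>h. 0 < h 0 \<and> h 0 \<le> H \<longrightarrow> extendable h (Suc 0)"
proof -
  obtain b where b: "0 < b" "\<And>k. 0 < k \<Longrightarrow> k < b \<Longrightarrow> \<exists>y>0. y = coeff 0 (L2 c2) k * G y"
    using first_stage_solvable[OF assms] by (auto simp: eventually_at_right_field)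
  \<comment> \<open>Halving b turns the strict bound k < b into a bound of the form k \<le>
    H.\<close>
  have "extendable h (Suc 0)" if h: "0 < h 0" "h 0 \<le> b / 2" for h
  proof -
    obtain y where y: "0 < y" "y = coeff 0 (L2 c2) (h 0) * G y"
      using b(2)[of "h 0"] b(1) h by auto
    obtain z' M' where z': "collocation_solution K G c2 h (Suc 0) z'" "z' \<in> borel_measurable borel"
        "\<And>s. 0 \<le> z' s" "\<And>s. z' s \<le> M'"
        "\<And>v. 0 < v \<Longrightarrow> v \<le> 1 \<Longrightarrow> z' (v * h 0) = L1 c2 v * 0 + L2 c2 v * G y"
      \<comment> \<open>The zero function solves the empty problem, and \<open>Z1 = 0\<close>
        because the lag term is 0 and \<open>G 0 = 0\<close>.\<close>
      by (rule collocation_solution_extend[where n = 0 and h = h and z = "\<lambda>_. 0" and M = 0 and ?Z1.0 = 0 and y = y])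
        (use y h G_0 G_pos[of y] in
          \<open>auto simp: lag_term_0 mesh_point_0 collocation_solution_def\<close>)
    have "z' (h 0) \<noteq> 0"
      using z'(5)[of 1] G_pos[OF y(1)] c2 by (simp add: L2_def)
    with z' h show ?thesis
      unfolding extendable_def by blast
  qed
  then show ?thesis
    using b(1) by (intro exI[of _ "b / 2"]) auto
qed

text \<open>The mesh point and the lag term at step n ignore \<open>h n\<close>, so the stage
  equation can be solved for all small k at once. Nontriviality is inherited, as its witness lies in
  the first mesh interval.\<close>

lemma extendable_step:
  assumes h: "\<And>i. i < n \<Longrightarrow> 0 < h i" and n: "0 < n"
    and ext: "extendable h n" and cont: "continuable (mesh_point h n)"
  shows "\<exists>H>0. \<forall>k. 0 < k \<and> k \<le> H \<longrightarrow> extendable (h(n := k)) (Suc n)"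
proof -
  obtain z M s0 where sol: "collocation_solution K G c2 h n z"
    and z: "z \<in> borel_measurable borel" "\<And>s. 0 \<le> z s" "\<And>s. z s \<le> M"
    and s0: "0 < s0" "s0 \<le> h 0" "z s0 \<noteq> 0"
    using ext unfolding extendable_def by blast
  let ?a = "mesh_point h n"
  define Z1 where "Z1 = G (lag_term K h z n ?a)"
  have a: "0 < ?a" using h n by (rule mesh_point_pos)
  obtain b where b: "0 < b" "\<And>k. 0 < k \<Longrightarrow> k < b \<Longrightarrow>
      \<exists>y\<ge>0. y = lag_term K h z n (?a + c2 * k) + coeff ?a (L1 c2) k * Z1 + coeff ?a (L2 c2) k * G y \<and>
        (1 - c2) * Z1 \<le> G y"
    using stage_solvable[OF a cont z, of Z1]
    by (auto simp: eventually_at_right_field Z1_def lag_term_def)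
  have "extendable (h(n := k)) (Suc n)" if k: "0 < k" "k \<le> b / 2" for k
  proof -
    let ?h = "h(n := k)"
    have mesh: "mesh_point ?h n = ?a" by (rule mesh_point_cong) simp
    have lag: "lag_term K ?h z n t = lag_term K h z n t" for t
      by (rule lag_term_cong) (auto simp: mesh)
    have sol': "collocation_solution K G c2 ?h n z"
      by (rule collocation_solution_cong[OF h _ _ sol]) auto
    obtain y where y: "0 \<le> y" "(1 - c2) * Z1 \<le> G y"
        "y = lag_term K h z n (?a + c2 * k) + coeff ?a (L1 c2) k * Z1 + coeff ?a (L2 c2) k * G y"
      using b(2)[of k] b(1) k by auto
    have "0 \<le> lag_term K h z n ?a"
      unfolding lag_term_def by (rule lag_integral(2)[OF a z])
    then obtain z' M' where z': "collocation_solution K G c2 ?h (Suc n) z'"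
        "z' \<in> borel_measurable borel" "\<And>s. 0 \<le> z' s" "\<And>s. z' s \<le> M'"
        "\<And>s. s \<le> ?a \<Longrightarrow> z' s = z s"
      by (rule_tac collocation_solution_extend[where n = n and h = ?h and z = z and M = M and ?Z1.0 = Z1 and y = y])
        (use h k sol' z y in \<open>auto simp: mesh lag Z1_def\<close>)
    have "h 0 \<le> ?a"
      using h n by (rule mesh_point_ge_first)
    with s0 z'(5) have "z' s0 \<noteq> 0" by simp
    with z' s0 n show ?thesis
      unfolding extendable_def by auto
  qed
  then show ?thesis
    using b(1) by (intro exI[of _ "b / 2"]) auto
qed

text \<open>For c2 = 1 both Lagrange polynomials are nonnegative on [0, 1] and the coefficients are
  values of \<open>G\<close>, so every solution is nonnegative and bounded on the mesh
  interval.\<close>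

lemma extendable_if_c2_eq_1:
  assumes c2_1: "c2 = 1" and h: "\<And>i. i < n \<Longrightarrow> 0 < h i" and n: "0 < n"
    and sol: "has_nontrivial_solution K G c2 h n"
  shows "extendable h n"
proof -
  obtain z s0 where z: "collocation_solution K G c2 h n z" and s0: "0 < s0" "s0 \<le> h 0" "z s0 \<noteq> 0"
    using sol by (auto simp: has_nontrivial_solution_iff)
  have "\<exists>w M. w \<in> borel_measurable borel \<and> (\<forall>s. 0 \<le> w s \<and> w s \<le> M) \<and>
          (\<forall>s. 0 < s \<and> s \<le> mesh_point h m \<longrightarrow> w s = z s)" if "m \<le> n" for m
    using that
  proof (induction m)
    case 0
    show ?case by (intro exI[of _ "\<lambda>_. 0"] exI[of _ 0]) (auto simp: mesh_point_0)
  next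
    case (Suc m)
    then obtain w M where w: "w \<in> borel_measurable borel" "\<And>s. 0 \<le> w s" "\<And>s. w s \<le> M"
        "\<And>s. 0 < s \<Longrightarrow> s \<le> mesh_point h m \<Longrightarrow> w s = z s"
      by auto
    let ?a = "mesh_point h m" and ?k = "h m"
    have k: "0 < ?k" using Suc h by simp
    have "\<exists>Z1 Z2. step_ok h z m Z1 Z2"
      using z Suc.prems by (simp add: collocation_solution_iff)
    then obtain Z1 Z2 where "step_ok h z m Z1 Z2" by blast
    then have Z: "\<And>v. 0 < v \<Longrightarrow> v \<le> 1 \<Longrightarrow> z (?a + v * ?k) = L1 c2 v * Z1 + L2 c2 v * Z2"
        and "\<exists>A1\<ge>0. Z1 = G A1" "\<exists>A2\<ge>0. Z2 = G A2"
      unfolding step_ok_def Let_def by (simp, blast, blast)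
    then have Z_nonneg: "0 \<le> Z1" "0 \<le> Z2"
      using G_nonneg by auto
    \<comment> \<open>The given \<open>z\<close> may be irregular outside the mesh interval; the
      copy built here agrees with it on the mesh so far and is 0 beyond.\<close>
    define w' where "w' s = (if s \<le> ?a then w s else if s \<le> ?a + ?k
      then L1 c2 ((s - ?a) / ?k) * Z1 + L2 c2 ((s - ?a) / ?k) * Z2 else 0)" for s
    have "w' \<in> borel_measurable borel"
      unfolding w'_def L1_def L2_def using w(1) by measurable
    moreover have "0 \<le> w' s \<and> w' s \<le> M + Z1 + Z2" for s
    proof -
      have M: "0 \<le> M" using w(2,3)[of 0] by linarith
      consider "s \<le> ?a" | "?a < s" "s \<le> ?a + ?k" | "?a + ?k < s" "?a < s"
        using k by linarith
      then show ?thesis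
      proof cases
        case 1
        then show ?thesis using w(2,3)[of s] Z_nonneg by (simp add: w'_def)
      next
        case 2
        define v where "v = (s - ?a) / ?k"
        have v: "0 \<le> v" "v \<le> 1" using 2 k by (auto simp: v_def)
        have "0 \<le> (1 - v) * Z1 \<and> (1 - v) * Z1 \<le> Z1" "0 \<le> v * Z2 \<and> v * Z2 \<le> Z2"
          using v Z_nonneg by (auto simp: mult_left_le_one_le)
        with 2 M show ?thesis
          by (simp add: w'_def v_def[symmetric] L1_def L2_def c2_1)
      next
        case 3
        then show ?thesis using M Z_nonneg by (simp add: w'_def)
      qed
    qed
    moreover have "w' s = z s" if "0 < s" "s \<le> mesh_point h (Suc m)" for s
    proof (cases "s \<le> ?a")
      case False
      then show ?thesis
        using that k Z(1)[of "(s - ?a) / ?k"] by (simp add: w'_def mesh_point_Suc)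
    qed (use that w in \<open>simp add: w'_def\<close>)
    ultimately show ?case by blast
  qed
  from this[of n] obtain w M where w: "w \<in> borel_measurable borel" "\<And>s. 0 \<le> w s \<and> w s \<le> M"
      "\<And>s. 0 < s \<Longrightarrow> s \<le> mesh_point h n \<Longrightarrow> w s = z s"
    by auto
  have "collocation_solution K G c2 h n w"
    by (rule collocation_solution_cong[OF h _ _ z]) (use w in auto)
  moreover have "h 0 \<le> mesh_point h n"
    using h n by (rule mesh_point_ge_first)
  ultimately show ?thesis
    unfolding extendable_def using w s0 by (intro exI[of _ w]) force
qed

section \<open>Necessity of the unbounded ratio\<close>

text \<open>A nontrivial first step gives Z2 > 0 with Z2 = G(\<beta> Z2), so the ratio at \<beta> Z2
  is 1/\<beta>. For small k this exceeds any supposed bound B.\<close>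

lemma unbounded_if_has_nontrivial_solution:
  assumes H: "0 < H" and ex: "\<And>h. 0 < h 0 \<Longrightarrow> h 0 \<le> H \<Longrightarrow> has_nontrivial_solution K G c2 h 1"
  shows "\<not> bounded ((\<lambda>y. G y / y) ` {0<..})"
proof
  assume "bounded ((\<lambda>y. G y / y) ` {0<..})"
  then obtain B where B: "0 < B" "\<And>y. 0 < y \<Longrightarrow> \<bar>G y / y\<bar> \<le> B"
    unfolding bounded_pos by auto
  have "eventually (\<lambda>k. coeff 0 (L2 c2) k < 1 / B) (at_right 0)"
    using B by (intro coeff_eventually_less[OF L2_props]) auto
  moreover have "eventually (\<lambda>k. k < H) (at_right 0)"
    using H by (intro order_tendstoD(2)[OF tendsto_ident_at])
  moreover have "eventually (\<lambda>k::real. 0 < k) (at_right 0)"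
    by (rule eventually_at_right_less)
  ultimately have "eventually (\<lambda>k. coeff 0 (L2 c2) k < 1 / B \<and> k < H \<and> 0 < k) (at_right 0)"
    by eventually_elim simp
  then obtain k where k: "coeff 0 (L2 c2) k < 1 / B" "k < H" "0 < k"
    using eventually_happens[of _ "at_right (0::real)"] by auto
  obtain z s where "collocation_solution K G c2 (\<lambda>_. k) 1 z" and s: "0 < s" "s \<le> k" "z s \<noteq> 0"
    using ex[of "\<lambda>_. k"] k by (auto simp: has_nontrivial_solution_iff)
  then obtain Z1 Z2 where "step_ok (\<lambda>_. k) z 0 Z1 Z2"
    by (auto simp: collocation_solution_iff)
  then have Z: "\<And>v. 0 < v \<Longrightarrow> v \<le> 1 \<Longrightarrow> z (v * k) = L1 c2 v * Z1 + L2 c2 v * Z2" "Z1 = 0"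
      "0 \<le> coeff 0 (L2 c2) k * Z2" "Z2 = G (coeff 0 (L2 c2) k * Z2)"
    by (auto simp: step_ok_def Let_def mesh_point_0 lag_term_0 G_0)
  have "Z2 \<noteq> 0"
    using Z(1)[of "s / k"] Z(2) s k by auto
  then have pos: "0 < Z2"
    using Z(3,4) G_nonneg by (metis less_eq_real_def)
  have c: "0 < coeff 0 (L2 c2) k" by (rule coeff_L2_pos[OF k(3)])
  have "\<bar>Z2 / (coeff 0 (L2 c2) k * Z2)\<bar> \<le> B"
    using B(2)[of "coeff 0 (L2 c2) k * Z2"] Z(4) pos c by simp
  then have "1 / coeff 0 (L2 c2) k \<le> B"
    using pos c by simp
  with k(1) c B(1) show False
    by (simp add: field_simps)
qed

section \<open>Sufficiency of the unbounded ratio\<close>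

lemma existence_near_zero_any_steps_if_unbounded:
  assumes "c2 = 1" and unb: "\<not> bounded ((\<lambda>y. G y / y) ` {0<..})"
  shows "existence_near_zero_any_steps K G c2"
  unfolding existence_near_zero_any_steps_def
proof (intro conjI allI impI)
  show "\<exists>H0>0. \<forall>h. 0 < h 0 \<and> h 0 \<le> H0 \<longrightarrow> has_nontrivial_solution K G c2 h 1"
    using extendable_start[OF unb] by (auto intro: extendable_imp_has_nontrivial_solution)
next
  fix n :: nat and h
  assume n: "1 \<le> n" and *: "(\<forall>i<n. 0 < h i) \<and> has_nontrivial_solution K G c2 h n"
  then have "extendable h n"
    by (intro extendable_if_c2_eq_1[OF \<open>c2 = 1\<close>]) auto
  moreover have "continuable (mesh_point h n)"
    using \<open>c2 = 1\<close> by (rule continuable_if_c2_eq_1)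
  ultimately have "\<exists>H>0. \<forall>k. 0 < k \<and> k \<le> H \<longrightarrow> extendable (h(n := k)) (Suc n)"
    using n * by (intro extendable_step) auto
  then show "\<exists>H>0. \<forall>k. 0 < k \<and> k \<le> H \<longrightarrow> has_nontrivial_solution K G c2 (h(n := k)) (Suc n)"
    by (auto intro: extendable_imp_has_nontrivial_solution)
qed

text \<open>For \<open>c2 < 1\<close> the kernel is only known to be continuous below \<open>\<epsilon>\<close>; the bounds on the step
  sizes are therefore chosen so small that the mesh never leaves \<open>{0..<\<epsilon>}\<close>.\<close>

lemma existence_near_zero_if_unbounded:
  assumes cont: "c2 = 1 \<or> (\<exists>\<epsilon>>0. \<forall>s. 0 \<le> s \<and> s < \<epsilon> \<longrightarrow> continuous_on {s<..<\<epsilon>} (\<lambda>t. K t s))"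
    and unb: "\<not> bounded ((\<lambda>y. G y / y) ` {0<..})"
  shows "existence_near_zero K G c2"
proof -
  obtain \<epsilon> :: real where \<epsilon>: "0 < \<epsilon>" "\<And>a. a < \<epsilon> \<Longrightarrow> continuable a"
  proof (cases "c2 = 1")
    case True
    then show ?thesis using that[of 1] continuable_if_c2_eq_1 by simp
  next
    case False
    then show ?thesis using cont that by (auto simp: continuable_def)
  qed
  \<comment> \<open>The invariant of the mesh construction. The case n = 0 is separate because no
    sign of \<open>h 0\<close> is known before the first step is taken.\<close>
  define R where "R h n \<longleftrightarrow> (\<forall>i<n. 0 < h i) \<and> (n = 0 \<or> extendable h n) \<and> mesh_point h n < \<epsilon>" for h n
  \<comment> \<open>The bound may depend only on the list \<open>hs\<close>. It is computed from one
    representative \<open>g\<close> with these first steps and transferred to all others by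
    \<open>extendable_cong\<close>; if no \<open>g\<close> satisfies the invariant, any bound works
    vacuously.\<close>
  have "\<exists>H>0. \<forall>h. map h [0..<length hs] = hs \<and> R h (length hs) \<and>
      0 < h (length hs) \<and> h (length hs) \<le> H \<longrightarrow> R h (Suc (length hs))" for hs
  proof (cases "\<exists>g. map g [0..<length hs] = hs \<and> R g (length hs)")
    case False
    then show ?thesis by (intro exI[of _ 1]) auto
  next
    case True
    define n where "n = length hs"
    obtain g where g: "map g [0..<n] = hs" "R g n" using True by (auto simp: n_def)
    \<comment> \<open>Half the remaining distance to \<epsilon>, so that the next mesh point still
      lies below \<epsilon>.\<close>
    define d where "d = (\<epsilon> - mesh_point g n) / 2"
    have d: "0 < d" using g(2) by (simp add: R_def d_def)
    have "\<exists>H>0. \<forall>k. 0 < k \<and> k \<le> H \<longrightarrow> extendable (g(n := k)) (Suc n)"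
    proof (cases "n = 0")
      case True
      then show ?thesis using extendable_start[OF unb] by auto
    next
      case False
      then show ?thesis using g(2) \<epsilon>(2) by (intro extendable_step) (auto simp: R_def)
    qed
    then obtain H where H: "0 < H" "\<And>k. 0 < k \<Longrightarrow> k \<le> H \<Longrightarrow> extendable (g(n := k)) (Suc n)"
      by blast
    have "R h (Suc n)" if h: "map h [0..<n] = hs" "0 < h n" "h n \<le> min H d" for h
    proof -
      have eq: "h i = g i" if "i < n" for i
      proof -
        have "map h [0..<n] ! i = map g [0..<n] ! i" using h(1) g(1) by simp
        with that show ?thesis by simp
      qed
      have pos: "0 < h i" if "i < Suc n" for i
        using that eq g(2) h(2) by (auto simp: R_def less_Suc_eq)
      have "extendable (g(n := h n)) (Suc n)"
        using h by (intro H(2)) auto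
      then have "extendable h (Suc n)"
        by (rule extendable_cong[rotated 3]) (use g(2) h(2) eq in \<open>auto simp: less_Suc_eq R_def\<close>)
      moreover have "mesh_point h (Suc n) < \<epsilon>"
      proof -
        have "mesh_point h n = mesh_point g n" using eq by (rule mesh_point_cong)
        then show ?thesis using h(3) d by (simp add: mesh_point_Suc d_def)
      qed
      ultimately show ?thesis using pos by (simp add: R_def)
    qed
    with H d show ?thesis
      by (intro exI[of _ "min H d"]) (auto simp: n_def)
  qed
  then obtain H where H: "\<And>hs. 0 < H hs" "\<And>hs h. map h [0..<length hs] = hs \<Longrightarrow> R h (length hs) \<Longrightarrow>
      0 < h (length hs) \<Longrightarrow> h (length hs) \<le> H hs \<Longrightarrow> R h (Suc (length hs))"
    by metis
  have step: "R h (Suc n)" if "R h n" "0 < h n" "h n \<le> H (map h [0..<n])" for h n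
    using H(2)[of h "map h [0..<n]"] that by simp
  have R: "R h n" if "\<And>i. i < n \<Longrightarrow> 0 < h i \<and> h i \<le> H (map h [0..<i])" for h n
    using that
  proof (induction n)
    case 0
    show ?case using \<epsilon> by (simp add: R_def mesh_point_0)
  next
    case (Suc n)
    then show ?case by (intro step) auto
  qed
  have sol: "has_nontrivial_solution K G c2 h (Suc n)"
    if "\<And>i. i < Suc n \<Longrightarrow> 0 < h i \<and> h i \<le> H (map h [0..<i])" for h n
    using R[OF that] by (auto simp: R_def intro: extendable_imp_has_nontrivial_solution)
  show ?thesis
    unfolding existence_near_zero_def
  proof (intro exI[of _ H] conjI allI impI)
    show "0 < H hs" for hs by (rule H(1))
    show "has_nontrivial_solution K G c2 h 1" if "0 < h 0 \<and> h 0 \<le> H []" for h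
      using sol[of 0 h] that by simp
    show "has_nontrivial_solution K G c2 h (Suc n)"
      if "(\<forall>i<n. 0 < h i \<and> h i \<le> H (map h [0..<i])) \<and> has_nontrivial_solution K G c2 h n"
        "0 < h n \<and> h n \<le> H (map h [0..<n])" for h n
      using that by (intro sol) (auto simp: less_Suc_eq)
  qed
qed

end

theorem proposition3p3:
  fixes K :: "real \<Rightarrow> real \<Rightarrow> real" and G :: "real \<Rightarrow> real" and c2 :: real
  assumes "kernel_conditions K"
    and "nonlinearity_conditions G"
    and "0 < c2" and "c2 \<le> 1"
    and "c2 = 1 \<or> (\<exists>\<epsilon>>0. \<forall>s. 0 \<le> s \<and> s < \<epsilon> \<longrightarrow> continuous_on {s<..<\<epsilon>} (\<lambda>t. K t s))"
  shows "(existence_near_zero K G c2 \<longleftrightarrow> \<not> bounded ((\<lambda>y. G y / y) ` {0<..})) \<and>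
         (c2 = 1 \<longrightarrow>
            (existence_near_zero_any_steps K G c2 \<longleftrightarrow> \<not> bounded ((\<lambda>y. G y / y) ` {0<..})))"
proof -
  interpret collocation_problem K G c2
    using assms by unfold_locales
  \<comment> \<open>Either notion of existence supplies a uniform bound for the first step, and this
    alone forces the ratio to be unbounded.\<close>
  have "\<exists>H>0. \<forall>h. 0 < h 0 \<and> h 0 \<le> H \<longrightarrow> has_nontrivial_solution K G c2 h 1"
    if "existence_near_zero K G c2"
    using that unfolding existence_near_zero_def by metis
  moreover have "\<exists>H>0. \<forall>h. 0 < h 0 \<and> h 0 \<le> H \<longrightarrow> has_nontrivial_solution K G c2 h 1"
    if "existence_near_zero_any_steps K G c2"
    using that unfolding existence_near_zero_any_steps_def by (rule conjunct1)
  ultimately have "\<not> bounded ((\<lambda>y. G y / y) ` {0<..})"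
    if "existence_near_zero K G c2 \<or> existence_near_zero_any_steps K G c2"
    using that unbounded_if_has_nontrivial_solution by metis
  then show ?thesis
    using existence_near_zero_if_unbounded[OF assms(5)]
      existence_near_zero_any_steps_if_unbounded by blast
qed

end
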